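(* Let $x,y,z\in\mathbb{R}^n$ have strictly positive entries, and let $p\ge 1$. Then $$\left(\sum_i\delta_s^p(x_i,y_i)\right)^{1/p}\le\left(\sum_i\delta_s^p(x_i,z_i)\right)^{1/p}+\left(\sum_i\delta_s^p(y_i,z_i)\right)^{1/p}.$$
   Context: For positive reals $a,b$: $\delta_s(a,b):=\sqrt{\log\left[(a+b)/(2\sqrt{ab})\right]}$, and $\delta_s^p(a,b)=(\delta_s(a,b))^p$. *)

theory Defs
  imports "HOL-Analysis.Analysis"
begin

(* Meaningful for positive a and b only: there (a + b) / (2 * sqrt (a * b)) >= 1,
   so the logarithm is nonnegative. *)
definition delta_s :: "real \<Rightarrow> real \<Rightarrow> real" where
  "delta_s a b = sqrt (ln ((a + b) / (2 * sqrt (a * b))))"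

end

theory Submission
  imports Defs
begin

text \<open>
  With \<open>t = \<bar>ln a - ln b\<bar> / 2\<close> one has \<open>\<delta>\<^sub>s(a, b) = F t\<close> for \<open>F t = sqrt (ln (cosh t))\<close>.
  Since \<open>ln (cosh t) / t\<^sup>2\<close> decreases on the positive half-line, so does \<open>F t / t\<close>; hence the
  increasing function \<open>F\<close> is subadditive and \<open>\<delta>\<^sub>s\<close> satisfies the triangle inequality.
  Minkowski's inequality then passes from the coordinates to the \<open>p\<close>-norm.
\<close>

text \<open>The endpoint 0 must be included because \<open>delta_s\<close> vanishes at equal
  arguments. There the convexity inequality reduces to \<open>t powr p \<le> t\<close> for
  \<open>0 < t < 1\<close>; away from 0, \<open>powr_convex\<close> applies.\<close>

lemma convex_on_powr_nonneg:
  fixes p :: real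
  assumes "p \<ge> 1"
  shows "convex_on {0..} (\<lambda>x. x powr p)"
proof (rule convex_on_linorderI)
  fix t x y :: real
  assume t: "0 < t" "t < 1" and xy: "x \<in> {0..}" "y \<in> {0..}" "x < y"
  show "((1 - t) *\<^sub>R x + t *\<^sub>R y) powr p \<le> (1 - t) * x powr p + t * y powr p"
  proof (cases "x = 0")
    case True
    have "t powr p \<le> t"
      using t assms by (intro powr_le_one_le) auto
    then show ?thesis
      using True t xy by (simp add: powr_mult mult_right_mono)
  next
    case False
    then show ?thesis
      using convex_onD[OF powr_convex[OF assms], of t x y] t xy by simp
  qed
qed simp

text \<open>Normalise by the p-norms \<open>A\<close> of \<open>f\<close> and \<open>B\<close> of
  \<open>g\<close>, apply convexity of the p-th power termwise, and sum: both normalised families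
  have p-th powers adding up to 1.\<close>

lemma minkowski_sum:
  fixes f g :: "'a \<Rightarrow> real" and p :: real
  assumes "finite I" "p \<ge> 1" and f: "\<And>i. i \<in> I \<Longrightarrow> f i \<ge> 0" and g: "\<And>i. i \<in> I \<Longrightarrow> g i \<ge> 0"
  shows "(\<Sum>i\<in>I. (f i + g i) powr p) powr (1 / p)
    \<le> (\<Sum>i\<in>I. f i powr p) powr (1 / p) + (\<Sum>i\<in>I. g i powr p) powr (1 / p)"
proof -
  define A where "A = (\<Sum>i\<in>I. f i powr p) powr (1 / p)"
  define B where "B = (\<Sum>i\<in>I. g i powr p) powr (1 / p)"
  have AB: "A \<ge> 0" "B \<ge> 0" by (simp_all add: A_def B_def)
  have Ap: "A powr p = (\<Sum>i\<in>I. f i powr p)" and Bp: "B powr p = (\<Sum>i\<in>I. g i powr p)"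
    using \<open>p \<ge> 1\<close> by (simp_all add: A_def B_def powr_powr sum_nonneg)
  show ?thesis
  proof (cases "A = 0 \<or> B = 0")
    case True
    then have "(\<forall>i\<in>I. f i = 0) \<or> (\<forall>i\<in>I. g i = 0)"
      using \<open>finite I\<close> by (auto simp: A_def B_def sum_nonneg_eq_0_iff)
    then show ?thesis
      by (elim disjE) simp_all
  next
    case False
    with AB have pos: "A > 0" "B > 0" by auto
    \<comment> \<open>With this weight, \<open>(f i + g i) / (A + B)\<close> is a convex combination
      of \<open>f i / A\<close> and \<open>g i / B\<close>.\<close>
    define t where "t = B / (A + B)"
    have t: "0 \<le> t" "t \<le> 1" "1 - t = A / (A + B)"
      using pos by (auto simp: t_def field_simps)
    have *: "(f i + g i) powr p
        \<le> (A + B) powr p * ((1 - t) * (f i powr p / A powr p) + t * (g i powr p / B powr p))"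
      if "i \<in> I" for i
    proof -
      have "(f i + g i) / (A + B) = (1 - t) * (f i / A) + t * (g i / B)"
        unfolding t(3) using pos by (simp add: t_def add_divide_distrib)
      then have le: "((f i + g i) / (A + B)) powr p
          \<le> (1 - t) * (f i / A) powr p + t * (g i / B) powr p"
        using convex_onD[OF convex_on_powr_nonneg[OF \<open>p \<ge> 1\<close>], of t "f i / A" "g i / B"]
          t f[OF that] g[OF that] pos by simp
      have "(f i + g i) powr p = (A + B) powr p * ((f i + g i) / (A + B)) powr p"
        using pos by (simp add: powr_divide f g that)
      also have "\<dots> \<le> (A + B) powr p * ((1 - t) * (f i / A) powr p + t * (g i / B) powr p)"
        by (intro mult_left_mono le) simp
      also have "(f i / A) powr p = f i powr p / A powr p"
        using pos f[OF that] by (simp add: powr_divide)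
      also have "(g i / B) powr p = g i powr p / B powr p"
        using pos g[OF that] by (simp add: powr_divide)
      finally show ?thesis .
    qed
    have "(\<Sum>i\<in>I. (f i + g i) powr p)
        \<le> (\<Sum>i\<in>I. (A + B) powr p * ((1 - t) * (f i powr p / A powr p) + t * (g i powr p / B powr p)))"
      by (rule sum_mono) (rule *)
    also have "\<dots> = (A + B) powr p * ((1 - t) * ((\<Sum>i\<in>I. f i powr p) / A powr p)
        + t * ((\<Sum>i\<in>I. g i powr p) / B powr p))"
      by (simp only: sum.distrib flip: sum_distrib_left sum_divide_distrib)
    \<comment> \<open>By \<open>Ap\<close> and \<open>Bp\<close> both quotients are 1, so the
      bracket is \<open>(1 - t) + t\<close>.\<close>
    also have "\<dots> = (A + B) powr p"
      using pos by (simp flip: Ap Bp)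
    finally have "(\<Sum>i\<in>I. (f i + g i) powr p) powr (1 / p) \<le> ((A + B) powr p) powr (1 / p)"
      using \<open>p \<ge> 1\<close> by (intro powr_mono2) (auto intro: sum_nonneg)
    also have "\<dots> = A + B"
      using \<open>p \<ge> 1\<close> pos by (simp add: powr_powr)
    finally show ?thesis
      by (simp add: A_def B_def)
  qed
qed

lemma sinh_real_ge_self:
  fixes t :: real
  assumes "t \<ge> 0"
  shows "t \<le> sinh t"
proof -
  have "sinh 0 - 0 \<le> sinh t - t"
    by (rule DERIV_nonneg_imp_nondecreasing[OF assms])
       (auto intro!: derivative_eq_intros exI simp: cosh_real_ge_1)
  then show ?thesis by simp
qed

text \<open>Fixes the sign of the derivative of \<open>ln (cosh t) / t\<^sup>2\<close>. Both sides
  vanish at 0, and their difference has derivative \<open>tanh x - x / cosh x ^ 2\<close>,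
  nonnegative because \<open>x \<le> sinh x \<le> sinh x * cosh x\<close>.\<close>

lemma mult_tanh_le_ln_cosh:
  fixes t :: real
  assumes "t \<ge> 0"
  shows "t * tanh t \<le> 2 * ln (cosh t)"
proof -
  have "2 * ln (cosh 0) - 0 * tanh 0 \<le> 2 * ln (cosh t) - t * tanh t"
  proof (rule DERIV_nonneg_imp_nondecreasing[OF assms], intro exI conjI)
    fix x :: real
    assume x: "0 \<le> x" "x \<le> t"
    show "((\<lambda>x. 2 * ln (cosh x) - x * tanh x) has_real_derivative
        2 * (sinh x / cosh x) - (tanh x + x * (1 - tanh x ^ 2))) (at x)"
      by (auto intro!: derivative_eq_intros simp: cosh_real_pos less_imp_neq[symmetric])
    have "x * 1 \<le> sinh x * cosh x"
      using x by (intro mult_mono sinh_real_ge_self cosh_real_ge_1) auto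
    then have "x / cosh x ^ 2 \<le> sinh x * cosh x / cosh x ^ 2"
      by (intro divide_right_mono) auto
    also have "\<dots> = tanh x"
      by (simp add: tanh_def power2_eq_square)
    finally have "x / cosh x ^ 2 \<le> tanh x" .
    moreover have "1 - tanh x ^ 2 = (cosh x ^ 2 - sinh x ^ 2) / cosh x ^ 2"
      by (simp add: tanh_def power_divide diff_divide_distrib)
    ultimately show "0 \<le> 2 * (sinh x / cosh x) - (tanh x + x * (1 - tanh x ^ 2))"
      by (simp add: hyperbolic_pythagoras flip: tanh_def)
  qed
  then show ?thesis by simp
qed

lemma ln_cosh_over_square_antimono:
  fixes s t :: real
  assumes "0 < s" "s \<le> t"
  shows "ln (cosh t) / t\<^sup>2 \<le> ln (cosh s) / s\<^sup>2"
proof (rule DERIV_nonpos_imp_nonincreasing[OF assms(2)], intro exI conjI)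
  fix x :: real
  assume "s \<le> x" "x \<le> t"
  then have x: "x > 0" using assms by simp
  show "((\<lambda>x. ln (cosh x) / x\<^sup>2) has_real_derivative
      (x * tanh x - 2 * ln (cosh x)) / x ^ 3) (at x)"
    using x by (auto intro!: derivative_eq_intros simp: cosh_real_pos tanh_def field_simps
      power2_eq_square power3_eq_cube)
  show "(x * tanh x - 2 * ln (cosh x)) / x ^ 3 \<le> 0"
    using x mult_tanh_le_ln_cosh[of x] by (simp add: divide_le_0_iff)
qed

lemma sqrt_ln_cosh_subadditive:
  fixes s t :: real
  assumes "0 \<le> s" "0 \<le> t"
  shows "sqrt (ln (cosh (s + t))) \<le> sqrt (ln (cosh s)) + sqrt (ln (cosh t))"
proof (cases "s = 0 \<or> t = 0")
  case False
  \<comment> \<open>This is F(s+t)/(s+t) \<le> F(u)/u multiplied by u. Adding the cases u = s and u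
    = t gives subadditivity, since the factors sum to 1.\<close>
  have *: "u / (s + t) * sqrt (ln (cosh (s + t))) \<le> sqrt (ln (cosh u))"
    if "0 < u" "u \<le> s + t" for u
  proof -
    have "sqrt (ln (cosh (s + t)) / (s + t)\<^sup>2) \<le> sqrt (ln (cosh u) / u\<^sup>2)"
      using ln_cosh_over_square_antimono[OF that] by (rule real_sqrt_le_mono)
    then show ?thesis
      using that by (simp add: real_sqrt_divide field_simps)
  qed
  have "sqrt (ln (cosh (s + t)))
      = s / (s + t) * sqrt (ln (cosh (s + t))) + t / (s + t) * sqrt (ln (cosh (s + t)))"
    using False assms by (simp flip: distrib_right add_divide_distrib)
  also have "\<dots> \<le> sqrt (ln (cosh s)) + sqrt (ln (cosh t))"
    using False assms by (intro add_mono *) auto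
  finally show ?thesis .
qed (use assms in auto)

text \<open>The ratio of arithmetic to geometric mean is (r + 1/r)/2 = cosh(ln r) for r = sqrt(a/b),
  and cosh is even.\<close>

lemma delta_s_eq_cosh:
  assumes "a > 0" "b > 0"
  shows "delta_s a b = sqrt (ln (cosh (\<bar>ln a - ln b\<bar> / 2)))"
proof -
  define u v where "u = sqrt a" and "v = sqrt b"
  have uv: "u > 0" "v > 0" "a = u\<^sup>2" "b = v\<^sup>2"
    using assms by (auto simp: u_def v_def)
  have "ln a - ln b = 2 * ln (u / v)"
    using uv by (simp add: ln_div ln_realpow)
  then have "cosh (\<bar>ln a - ln b\<bar> / 2) = cosh \<bar>ln (u / v)\<bar>"
    by (simp add: abs_mult)
  also have "\<dots> = (u / v + v / u) / 2"
    using uv by (simp add: cosh_ln_real inverse_eq_divide)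
  also have "\<dots> = (a + b) / (2 * sqrt (a * b))"
    using uv by (simp add: real_sqrt_mult field_simps power2_eq_square)
  finally show ?thesis by (simp add: delta_s_def)
qed

lemma delta_s_nonneg: "a > 0 \<Longrightarrow> b > 0 \<Longrightarrow> delta_s a b \<ge> 0"
  by (simp add: delta_s_eq_cosh cosh_real_ge_1)

lemma delta_s_triangle:
  assumes "a > 0" "b > 0" "c > 0"
  shows "delta_s a b \<le> delta_s a c + delta_s b c"
proof -
  define s t where "s = \<bar>ln a - ln c\<bar> / 2" and "t = \<bar>ln b - ln c\<bar> / 2"
  \<comment> \<open>The triangle inequality on the logarithmic scale, carried over by monotonicity
    of cosh on nonnegative reals.\<close>
  have "cosh (\<bar>ln a - ln b\<bar> / 2) \<le> cosh (s + t)"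
    by (subst cosh_real_nonneg_le_iff) (auto simp: s_def t_def)
  then have "delta_s a b \<le> sqrt (ln (cosh (s + t)))"
    using assms by (simp add: delta_s_eq_cosh cosh_real_pos)
  also have "\<dots> \<le> sqrt (ln (cosh s)) + sqrt (ln (cosh t))"
    by (rule sqrt_ln_cosh_subadditive) (simp_all add: s_def t_def)
  finally show ?thesis
    using assms by (simp add: delta_s_eq_cosh s_def t_def)
qed

theorem corollary3p5:
  fixes x y z :: "real ^ 'n" and p :: real
  assumes "\<And>i. x $ i > 0" and "\<And>i. y $ i > 0" and "\<And>i. z $ i > 0"
    and "p \<ge> 1"
  shows "(\<Sum>i\<in>UNIV. delta_s (x $ i) (y $ i) powr p) powr (1 / p)
    \<le> (\<Sum>i\<in>UNIV. delta_s (x $ i) (z $ i) powr p) powr (1 / p)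
      + (\<Sum>i\<in>UNIV. delta_s (y $ i) (z $ i) powr p) powr (1 / p)"
proof -
  have "(\<Sum>i\<in>UNIV. delta_s (x $ i) (y $ i) powr p) powr (1 / p)
      \<le> (\<Sum>i\<in>UNIV. (delta_s (x $ i) (z $ i) + delta_s (y $ i) (z $ i)) powr p) powr (1 / p)"
    using assms
    by (intro powr_mono2 sum_mono sum_nonneg delta_s_triangle delta_s_nonneg) auto
  also have "\<dots> \<le> (\<Sum>i\<in>UNIV. delta_s (x $ i) (z $ i) powr p) powr (1 / p)
      + (\<Sum>i\<in>UNIV. delta_s (y $ i) (z $ i) powr p) powr (1 / p)"
    using assms by (intro minkowski_sum delta_s_nonneg) auto
  finally show ?thesis .
qed

end
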